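(* Let $q\in\mathbb{C}$ with $|q|<1$. For every positive integer $n$, $$\xi_{n,q}=\frac{G_{n+1,q}}{n+1}.$$
   Context: For $q\in\mathbb{C}$ with $|q|<1$ put $[k]_q=\frac{1-q^k}{1-q}$ for integers $k\ge 0$; in particular $[2]_q=1+q$. The modified $q$-Euler numbers $\xi_{n,q}$ ($n\ge0$) are defined by $\xi_{0,q}=\frac{[2]_q}{2}$ and the recurrence $(q\xi+1)^k+\xi_{k,q}=[2]_q$ if $k=0$ and $=0$ if $k\ne0$, where after binomial expansion $\xi^i$ is replaced by $\xi_{i,q}$; that is, for $k\ge1$, $\sum_{i=0}^{k}\binom{k}{i}q^i\xi_{i,q}+\xi_{k,q}=0$. The $q$-Genocchi numbers $G_{n,q}$ ($n\ge 0$) are defined by the generating function $$[2]_q\,t\sum_{k=0}^{\infty}(-1)^k e^{[k]_q t}=\sum_{n=0}^{\infty}G_{n,q}\frac{t^n}{n!},$$ read as an identity of formal power series in $t$, where for each power of $t$ the alternating series over $k$ is evaluated by Abel summation, $\sum_{k\ge0}(-1)^k a_k:=\lim_{r\to1^-}\sum_{k\ge0}(-1)^k r^k a_k$. Explicitly, $G_{0,q}=0$ and, for $n\ge1$, $G_{n,q}=n[2]_q\lim_{r\to1^-}\sum_{k=0}^{\infty}(-1)^k r^k[k]_q^{\,n-1}$. Convention: $0^0=1$. *)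

theory Defs
  imports Complex_Main "HOL-Computational_Algebra.Formal_Power_Series"
begin

definition qint :: "complex \<Rightarrow> nat \<Rightarrow> complex" where
  "qint q k = (1 - q ^ k) / (1 - q)"

text \<open>The clause for \<open>k = 0\<close> of the umbral recurrence \<open>(q\<xi> + 1)^k + \<xi>_k = [k = 0] [2]_q\<close>
  reads \<open>2 \<xi>_0 = [2]_q\<close>, so it repeats the initial value.\<close>

definition mod_qEuler_rec :: "complex \<Rightarrow> (nat \<Rightarrow> complex) \<Rightarrow> bool" where
  "mod_qEuler_rec q \<xi> \<longleftrightarrow>
     \<xi> 0 = qint q 2 / 2 \<and>
     (\<forall>k. (\<Sum>i=0..k. of_nat (k choose i) * q ^ i * \<xi> i) + \<xi> k = (if k = 0 then qint q 2 else 0))"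

definition mod_qEuler :: "complex \<Rightarrow> nat \<Rightarrow> complex" where
  "mod_qEuler q = (THE \<xi>. mod_qEuler_rec q \<xi>)"

definition has_alt_Abel_sum :: "(nat \<Rightarrow> complex) \<Rightarrow> complex \<Rightarrow> bool" where
  "has_alt_Abel_sum a s \<longleftrightarrow>
     (\<forall>r\<in>{0<..<1::real}. summable (\<lambda>k. (-1) ^ k * of_real r ^ k * a k)) \<and>
     ((\<lambda>r. \<Sum>k. (-1) ^ k * of_real r ^ k * a k) \<longlongrightarrow> s) (at_left (1::real))"

definition alt_Abel_sum :: "(nat \<Rightarrow> complex) \<Rightarrow> complex" where
  "alt_Abel_sum a = (THE s. has_alt_Abel_sum a s)"

text \<open>The formal power series \<open>[2]_q t \<Sum>_k (-1)^k e^([k]_q t)\<close>, the sum over \<open>k\<close> being taken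
  coefficientwise in the sense of Abel.\<close>

definition qGenocchi_gf :: "complex \<Rightarrow> complex fps" where
  "qGenocchi_gf q =
     fps_const (qint q 2) * fps_X * Abs_fps (\<lambda>m. alt_Abel_sum (\<lambda>k. fps_nth (fps_exp (qint q k)) m))"

definition qGenocchi :: "complex \<Rightarrow> nat \<Rightarrow> complex" where
  "qGenocchi q n = fact n * fps_nth (qGenocchi_gf q) n"


text \<open>Both descriptions above are proper: for \<open>|q| < 1\<close> the recurrence has exactly one solution,
  and every Abel sum occurring in the generating function exists and is unique.\<close>

lemma one_plus_power_nonzero:
  fixes q :: complex
  assumes "norm q < 1"
  shows "1 + q ^ k \<noteq> 0"
proof (cases "k = 0")
  case False
  then have "norm (q ^ k) < 1"
    using assms by (simp add: norm_power power_less_one_iff)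
  then show ?thesis
    by (metis add_eq_0_iff norm_minus_cancel norm_one less_irrefl)
qed simp

fun mod_qEuler_aux :: "complex \<Rightarrow> nat \<Rightarrow> complex" where
  "mod_qEuler_aux q k =
     (if k = 0 then qint q 2 / 2
      else - (\<Sum>i<k. of_nat (k choose i) * q ^ i * mod_qEuler_aux q i) / (1 + q ^ k))"

declare mod_qEuler_aux.simps [simp del]

lemma mod_qEuler_rec_iff:
  assumes "norm q < 1"
  shows "mod_qEuler_rec q \<xi> \<longleftrightarrow>
    (\<forall>k. \<xi> k = (if k = 0 then qint q 2 / 2
       else - (\<Sum>i<k. of_nat (k choose i) * q ^ i * \<xi> i) / (1 + q ^ k)))"
proof -
  have *: "((\<Sum>i=0..k. of_nat (k choose i) * q ^ i * \<xi> i) + \<xi> k = 0) \<longleftrightarrow>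
      \<xi> k = - (\<Sum>i<k. of_nat (k choose i) * q ^ i * \<xi> i) / (1 + q ^ k)" for k
  proof -
    have "(\<Sum>i=0..k. of_nat (k choose i) * q ^ i * \<xi> i) + \<xi> k =
        (\<Sum>i<k. of_nat (k choose i) * q ^ i * \<xi> i) + (1 + q ^ k) * \<xi> k"
      by (simp add: atLeast0AtMost lessThan_Suc_atMost [symmetric] algebra_simps)
    then show ?thesis
      using one_plus_power_nonzero [OF assms, of k]
      by (simp only: eq_divide_eq add_eq_0_iff2 mult.commute if_False) (auto simp: equation_minus_iff)
  qed
  have "mod_qEuler_rec q \<xi> \<longleftrightarrow> \<xi> 0 = qint q 2 / 2 \<and>
      (\<forall>k. k \<noteq> 0 \<longrightarrow> (\<Sum>i=0..k. of_nat (k choose i) * q ^ i * \<xi> i) + \<xi> k = 0)"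
    unfolding mod_qEuler_rec_def by (rule conj_cong [OF refl], rule all_cong1) (auto simp: mult.commute)
  moreover have "(x 0 = a \<and> (\<forall>k. k \<noteq> 0 \<longrightarrow> x k = g k)) \<longleftrightarrow> (\<forall>k. x k = (if k = 0 then a else g k))"
    for x g :: "nat \<Rightarrow> complex" and a
    by metis
  ultimately show ?thesis
    unfolding * by (rule trans)
qed

lemma mod_qEuler_rec_ex1:
  assumes "norm q < 1"
  shows "\<exists>!\<xi>. mod_qEuler_rec q \<xi>"
proof
  show "mod_qEuler_rec q (mod_qEuler_aux q)"
    unfolding mod_qEuler_rec_iff [OF assms] by (metis mod_qEuler_aux.simps)
next
  fix \<xi> assume "mod_qEuler_rec q \<xi>"
  then have \<xi>: "\<xi> k = (if k = 0 then qint q 2 / 2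
       else - (\<Sum>i<k. of_nat (k choose i) * q ^ i * \<xi> i) / (1 + q ^ k))" for k
    unfolding mod_qEuler_rec_iff [OF assms] by blast
  have "\<xi> k = mod_qEuler_aux q k" for k
  proof (induction k rule: less_induct)
    case (less k)
    then have "(\<Sum>i<k. of_nat (k choose i) * q ^ i * \<xi> i) =
        (\<Sum>i<k. of_nat (k choose i) * q ^ i * mod_qEuler_aux q i)"
      by (intro sum.cong) auto
    then show ?case
      by (subst \<xi>, subst mod_qEuler_aux.simps) simp
  qed
  then show "\<xi> = mod_qEuler_aux q" by blast
qed

lemma mod_qEuler_rec_mod_qEuler:
  assumes "norm q < 1"
  shows "mod_qEuler_rec q (mod_qEuler q)"
  unfolding mod_qEuler_def by (rule theI' [OF mod_qEuler_rec_ex1 [OF assms]])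

lemma alt_Abel_sum_eq:
  assumes "has_alt_Abel_sum a s"
  shows "alt_Abel_sum a = s"
  unfolding alt_Abel_sum_def
proof (rule the_equality [where P = "has_alt_Abel_sum a"], fact assms)
  fix s' assume "has_alt_Abel_sum a s'"
  with assms show "s' = s"
    unfolding has_alt_Abel_sum_def
    using tendsto_unique [OF trivial_limit_at_left_real] by blast
qed

lemma has_alt_Abel_sum_geometric:
  assumes "norm z \<le> 1" "1 + z \<noteq> 0"
  shows "has_alt_Abel_sum (\<lambda>k. z ^ k) (1 / (1 + z))"
proof -
  have eq: "(\<lambda>k. (-1) ^ k * of_real r ^ k * z ^ k) = (\<lambda>k. (- (of_real r * z)) ^ k)" for r :: real
    by (auto simp: power_mult_distrib [symmetric])
  have small: "norm (- (of_real r * z)) < 1" if "r \<in> {0<..<1}" for r :: real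
  proof -
    have "norm (- (of_real r * z)) = r * norm z"
      using that by (simp add: norm_mult)
    also have "\<dots> \<le> r * 1"
      using that assms by (intro mult_left_mono) auto
    finally show ?thesis using that by simp
  qed
  have "((\<lambda>r. 1 / (1 + of_real r * z)) \<longlongrightarrow> 1 / (1 + of_real 1 * z)) (at_left (1::real))"
    using assms by (intro tendsto_intros) auto
  moreover have "eventually (\<lambda>r. r \<in> {0<..<1}) (at_left (1::real))"
    by (rule eventually_at_left_real) simp
  then have "eventually (\<lambda>r. 1 / (1 + of_real r * z) = (\<Sum>k. (-1) ^ k * of_real r ^ k * z ^ k))
      (at_left (1::real))"
    by eventually_elim (use suminf_geometric [OF small] in \<open>simp add: eq\<close>)
  ultimately have "((\<lambda>r. \<Sum>k. (-1) ^ k * of_real r ^ k * z ^ k) \<longlongrightarrow> 1 / (1 + z)) (at_left (1::real))"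
    by (auto intro: Lim_transform_eventually)
  then show ?thesis
    unfolding has_alt_Abel_sum_def eq using summable_geometric [OF small] by blast
qed

lemma has_alt_Abel_sum_sum:
  assumes "\<And>l. l \<in> A \<Longrightarrow> has_alt_Abel_sum (a l) (s l)"
  shows "has_alt_Abel_sum (\<lambda>k. \<Sum>l\<in>A. c l * a l k) (\<Sum>l\<in>A. c l * s l)"
proof -
  have eq: "(\<lambda>k. (-1) ^ k * of_real r ^ k * (\<Sum>l\<in>A. c l * a l k)) =
      (\<lambda>k. \<Sum>l\<in>A. c l * ((-1) ^ k * of_real r ^ k * a l k))" for r :: real
    by (simp add: sum_distrib_left mult_ac)
  have sm: "summable (\<lambda>k. (-1) ^ k * of_real r ^ k * a l k)" if "l \<in> A" "r \<in> {0<..<1}" for l and r :: real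
    using assms that unfolding has_alt_Abel_sum_def by blast
  have "((\<lambda>r. \<Sum>l\<in>A. c l * (\<Sum>k. (-1) ^ k * of_real r ^ k * a l k)) \<longlongrightarrow> (\<Sum>l\<in>A. c l * s l))
      (at_left (1::real))"
    using assms unfolding has_alt_Abel_sum_def by (intro tendsto_intros) auto
  moreover have "eventually (\<lambda>r. r \<in> {0<..<1}) (at_left (1::real))"
    by (rule eventually_at_left_real) simp
  then have "eventually (\<lambda>r. (\<Sum>l\<in>A. c l * (\<Sum>k. (-1) ^ k * of_real r ^ k * a l k)) =
      (\<Sum>k. (-1) ^ k * of_real r ^ k * (\<Sum>l\<in>A. c l * a l k))) (at_left (1::real))"
    by eventually_elim (simp add: eq suminf_sum suminf_mult summable_mult sm)
  ultimately show ?thesis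
    unfolding has_alt_Abel_sum_def
    by (auto intro: Lim_transform_eventually simp: eq intro!: summable_sum summable_mult sm)
qed

lemma has_alt_Abel_sum_qint_power:
  assumes "norm q < 1"
  shows "has_alt_Abel_sum (\<lambda>k. qint q k ^ m)
    (\<Sum>l\<le>m. (of_nat (m choose l) * (-1) ^ l / (1 - q) ^ m) * (1 / (1 + q ^ l)))"
proof -
  have "qint q k ^ m = (\<Sum>l\<le>m. (of_nat (m choose l) * (-1) ^ l / (1 - q) ^ m) * (q ^ l) ^ k)" for k
  proof -
    have "(1 - q ^ k) ^ m = (\<Sum>l\<le>m. of_nat (m choose l) * (- (q ^ k)) ^ l * 1 ^ (m - l))"
      using binomial_ring [of "- (q ^ k)" 1 m] by simp
    also have "\<dots> = (\<Sum>l\<le>m. of_nat (m choose l) * (-1) ^ l * (q ^ l) ^ k)"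
      by (intro sum.cong refl)
        (simp add: power_minus [of "q ^ k"] power_mult [symmetric] mult.commute [of k])
    finally show ?thesis
      by (simp add: qint_def power_divide sum_divide_distrib)
  qed
  moreover have "has_alt_Abel_sum
      (\<lambda>k. \<Sum>l\<le>m. (of_nat (m choose l) * (-1) ^ l / (1 - q) ^ m) * (q ^ l) ^ k)
      (\<Sum>l\<le>m. (of_nat (m choose l) * (-1) ^ l / (1 - q) ^ m) * (1 / (1 + q ^ l)))"
    using assms
    by (intro has_alt_Abel_sum_sum has_alt_Abel_sum_geometric one_plus_power_nonzero)
      (auto simp: norm_power power_le_one)
  ultimately show ?thesis by simp
qed

lemma has_alt_Abel_sum_alt_Abel_sum_fps_exp:
  assumes "norm q < 1"
  shows "has_alt_Abel_sum (\<lambda>k. fps_nth (fps_exp (qint q k)) m)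
    (alt_Abel_sum (\<lambda>k. fps_nth (fps_exp (qint q k)) m))"
proof -
  have "\<exists>s. has_alt_Abel_sum (\<lambda>k. fps_nth (fps_exp (qint q k)) m) s"
    using has_alt_Abel_sum_sum [of "{()}" "\<lambda>_ k. qint q k ^ m" _ "\<lambda>_. 1 / fact m",
        OF has_alt_Abel_sum_qint_power [OF assms]] by auto
  then show ?thesis using alt_Abel_sum_eq by metis
qed

end

theory Submission
  imports Defs
begin

text \<open>The numbers \<open>G_(n+1) / (n+1)\<close> are the \<open>q\<close>-analogue \<open>[2]_q \<Sum>_k (-1)^k [k]_q^n\<close> of the
  alternating power sums, and they satisfy the recurrence of the \<open>\<xi>_n\<close> because of
  \<open>[k+1]_q = 1 + q [k]_q\<close>.  Indeed, expanding \<open>[k+1]_q^n\<close> binomially shows that the umbral power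
  \<open>(q\<xi> + 1)^n\<close> stands for the Abel sum of the shifted sequence \<open>[k+1]_q^n\<close>
  (\<open>alt_Abel_sum_qint_power_shift\<close>).  Dropping the first term of an alternating series and
  re-indexing reverses its sign, so this shifted sum is \<open>0^n\<close> minus the original one
  (\<open>has_alt_Abel_sum_Suc\<close>).  Hence the two terms of the recurrence cancel up to \<open>[2]_q 0^n\<close>, which
  is its right-hand side.  As the recurrence has only one solution, the two families agree.\<close>

lemma has_alt_Abel_sum_cmult:
  assumes "has_alt_Abel_sum a s"
  shows "has_alt_Abel_sum (\<lambda>k. c * a k) (c * s)"
  using has_alt_Abel_sum_sum [of "{()}" "\<lambda>_. a" "\<lambda>_. s" "\<lambda>_. c"] assms by simp

text \<open>Formally \<open>\<Sum>_k (-1)^k a_(k+1) = a_0 - \<Sum>_k (-1)^k a_k\<close>.  With the weights \<open>r^k\<close> this holds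
  up to a factor \<open>1/r\<close>, which disappears in the limit.\<close>

lemma has_alt_Abel_sum_Suc:
  assumes "has_alt_Abel_sum a s"
  shows "has_alt_Abel_sum (\<lambda>k. a (Suc k)) (a 0 - s)"
proof -
  define t where "t r k = (-1) ^ k * complex_of_real r ^ k * a k" for r k
  have t_0: "t r 0 = a 0" for r
    by (simp add: t_def)
  have summable: "summable (t r)" if "r \<in> {0<..<1}" for r
    using assms that unfolding has_alt_Abel_sum_def t_def by blast
  have limit: "((\<lambda>r. \<Sum>k. t r k) \<longlongrightarrow> s) (at_left 1)"
    using assms unfolding has_alt_Abel_sum_def t_def by blast
  have shift: "(\<lambda>k. (-1) ^ k * of_real r ^ k * a (Suc k)) = (\<lambda>k. - (1 / of_real r) * t r (Suc k))"
    if "r \<in> {0<..<1}" for r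
    using that by (auto simp: t_def field_simps)
  have summable_Suc: "summable (\<lambda>k. t r (Suc k))" if "r \<in> {0<..<1}" for r
    using summable [OF that] by (simp only: summable_Suc_iff)
  have "((\<lambda>r. - (1 / of_real r) * ((\<Sum>k. t r k) - a 0)) \<longlongrightarrow> - (1 / of_real 1) * (s - a 0))
      (at_left (1::real))"
    by (intro tendsto_intros limit) auto
  moreover have "eventually (\<lambda>r. r \<in> {0<..<1}) (at_left (1::real))"
    by (rule eventually_at_left_real) simp
  then have "eventually (\<lambda>r. - (1 / of_real r) * ((\<Sum>k. t r k) - a 0) =
      (\<Sum>k. (-1) ^ k * of_real r ^ k * a (Suc k))) (at_left (1::real))"
  proof eventually_elim
    case (elim r)
    have "(\<Sum>k. t r (Suc k)) = (\<Sum>k. t r k) - a 0"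
      using suminf_split_head [OF summable [OF elim]] t_0 by metis
    then show ?case
      by (simp only: shift [OF elim] suminf_mult [OF summable_Suc [OF elim]])
  qed
  ultimately have "((\<lambda>r. \<Sum>k. (-1) ^ k * of_real r ^ k * a (Suc k)) \<longlongrightarrow> a 0 - s) (at_left (1::real))"
    by (auto intro: Lim_transform_eventually)
  moreover have "summable (\<lambda>k. (-1) ^ k * of_real r ^ k * a (Suc k))" if "r \<in> {0<..<1}" for r
    unfolding shift [OF that] by (intro summable_mult summable_Suc that)
  ultimately show ?thesis
    unfolding has_alt_Abel_sum_def by blast
qed

lemma qint_Suc:
  assumes "q \<noteq> 1"
  shows "qint q (Suc k) = q * qint q k + 1"
  using assms by (simp add: qint_def field_simps)

lemma has_alt_Abel_sum_alt_Abel_sum_qint_power: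
  assumes "norm q < 1"
  shows "has_alt_Abel_sum (\<lambda>k. qint q k ^ m) (alt_Abel_sum (\<lambda>k. qint q k ^ m))"
  using has_alt_Abel_sum_qint_power [OF assms] alt_Abel_sum_eq by metis

text \<open>Both sides are the Abel sum of \<open>[k+1]_q^m\<close>: on the left it is expanded by
  \<open>[k+1]_q = q [k]_q + 1\<close>, on the right it is evaluated by the shift rule, with \<open>[0]_q = 0\<close>.\<close>

lemma alt_Abel_sum_qint_power_shift:
  assumes "norm q < 1"
  shows "(\<Sum>i\<le>m. of_nat (m choose i) * q ^ i * alt_Abel_sum (\<lambda>k. qint q k ^ i)) =
    0 ^ m - alt_Abel_sum (\<lambda>k. qint q k ^ m)"
proof -
  have "q \<noteq> 1"
    using assms by auto
  then have "qint q (Suc k) ^ m = (\<Sum>i\<le>m. (of_nat (m choose i) * q ^ i) * qint q k ^ i)" for k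
    by (simp add: qint_Suc binomial_ring power_mult_distrib mult.assoc)
  moreover have "has_alt_Abel_sum (\<lambda>k. \<Sum>i\<le>m. (of_nat (m choose i) * q ^ i) * qint q k ^ i)
      (\<Sum>i\<le>m. (of_nat (m choose i) * q ^ i) * alt_Abel_sum (\<lambda>k. qint q k ^ i))"
    by (intro has_alt_Abel_sum_sum has_alt_Abel_sum_alt_Abel_sum_qint_power assms)
  ultimately have "alt_Abel_sum (\<lambda>k. qint q (Suc k) ^ m) =
      (\<Sum>i\<le>m. of_nat (m choose i) * q ^ i * alt_Abel_sum (\<lambda>k. qint q k ^ i))"
    by (simp add: alt_Abel_sum_eq)
  moreover have "alt_Abel_sum (\<lambda>k. qint q (Suc k) ^ m) =
      qint q 0 ^ m - alt_Abel_sum (\<lambda>k. qint q k ^ m)"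
    by (intro alt_Abel_sum_eq has_alt_Abel_sum_Suc has_alt_Abel_sum_alt_Abel_sum_qint_power assms)
  ultimately show ?thesis
    by (simp add: qint_def)
qed

lemma mod_qEuler_eq_alt_Abel_sum:
  assumes "norm q < 1"
  shows "mod_qEuler q m = qint q 2 * alt_Abel_sum (\<lambda>k. qint q k ^ m)"
proof -
  define A where "A m = alt_Abel_sum (\<lambda>k. qint q k ^ m)" for m
  have rec: "(\<Sum>i\<le>m. of_nat (m choose i) * q ^ i * A i) + A m = 0 ^ m" for m
    using alt_Abel_sum_qint_power_shift [OF assms, of m] by (simp add: A_def)
  have "A 0 = 1 / 2"
    using rec [of 0] by (simp add: field_simps)
  moreover have "(\<Sum>i=0..m. of_nat (m choose i) * q ^ i * (qint q 2 * A i)) + qint q 2 * A m =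
      qint q 2 * ((\<Sum>i\<le>m. of_nat (m choose i) * q ^ i * A i) + A m)" for m
    by (simp add: atLeast0AtMost sum_distrib_left distrib_left mult_ac)
  ultimately have "mod_qEuler_rec q (\<lambda>m. qint q 2 * A m)"
    unfolding mod_qEuler_rec_def rec by simp
  then have "mod_qEuler q = (\<lambda>m. qint q 2 * A m)"
    using mod_qEuler_rec_ex1 [OF assms] mod_qEuler_rec_mod_qEuler [OF assms] by blast
  then show ?thesis
    by (simp add: A_def)
qed

lemma qGenocchi_Suc_eq_alt_Abel_sum:
  assumes "norm q < 1"
  shows "qGenocchi q (Suc m) = of_nat (Suc m) * qint q 2 * alt_Abel_sum (\<lambda>k. qint q k ^ m)"
proof -
  have "alt_Abel_sum (\<lambda>k. fps_nth (fps_exp (qint q k)) m) =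
      1 / fact m * alt_Abel_sum (\<lambda>k. qint q k ^ m)"
    using has_alt_Abel_sum_cmult [OF has_alt_Abel_sum_alt_Abel_sum_qint_power [OF assms, of m],
        of "1 / fact m"]
    by (intro alt_Abel_sum_eq) simp
  then show ?thesis
    by (simp add: qGenocchi_def qGenocchi_gf_def mult.assoc)
qed

theorem theorem3:
  fixes q :: complex and n :: nat
  assumes "norm q < 1" and "n \<ge> 1"
  shows "mod_qEuler q n = qGenocchi q (n + 1) / of_nat (n + 1)"
proof -
  have "of_nat (Suc n) \<noteq> (0 :: complex)"
    by (rule of_nat_neq_0)
  then show ?thesis
    using assms(1)
    by (simp add: mod_qEuler_eq_alt_Abel_sum qGenocchi_Suc_eq_alt_Abel_sum del: of_nat_Suc)
qed

end
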